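(* The space $(A^1)^\perp+C$ is not an algebra; that is, it is not closed under pointwise (a.e.) multiplication of functions in $L^\infty$.
   Context: $D$ is the open unit disc in $\mathbb{C}$, $dA=\frac1\pi r\,dr\,d\theta$ is normalized Lebesgue measure on $D$, and $L^\infty=L^\infty(D,dA)$ (complex-valued). The Bergman space $A^1$ is the Banach space of holomorphic functions $f$ on $D$ with $\|f\|=\int_D|f|\,dA<\infty$. The annihilator is $(A^1)^\perp=\{\psi\in L^\infty:\int_D f\overline{\psi}\,dA=0\text{ for all }f\in A^1\}$. $C=C(\overline{D})$ is the space of continuous complex functions on $\overline{D}$, regarded as a subspace of $L^\infty$. $(A^1)^\perp+C$ denotes the sum of these two subspaces. *)

theory Defs
  imports "HOL-Analysis.Analysis"
begin

text \<open>
  Elements of \<open>L\<^sup>\<infinity>\<close> are represented by functions of type \<^typ>\<open>complex \<Rightarrow> complex\<close>; their values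
  outside the open unit disc are irrelevant. All subsets of \<open>L\<^sup>\<infinity>\<close> below are closed under
  almost everywhere equality of measurable functions, so they correspond exactly to sets of
  equivalence classes.
\<close>

definition dA :: "complex measure" where
  "dA = scale_measure (ennreal (1 / pi)) (lebesgue_on (ball 0 1))"

definition Linf :: "(complex \<Rightarrow> complex) set" where
  "Linf = {f \<in> borel_measurable dA. \<exists>B. AE z in dA. norm (f z) \<le> B}"

text \<open>The norm \<open>\<integral>|f| dA\<close> of a holomorphic \<open>f\<close> is finite iff \<open>f\<close> is Bochner integrable.\<close>

definition bergman_A1 :: "(complex \<Rightarrow> complex) set" where
  "bergman_A1 = {f. f holomorphic_on ball 0 1 \<and> integrable dA f}"

definition A1_perp :: "(complex \<Rightarrow> complex) set" where
  "A1_perp = {\<psi> \<in> Linf. \<forall>f \<in> bergman_A1. (LINT z|dA. f z * cnj (\<psi> z)) = 0}"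

definition C_closed_disc :: "(complex \<Rightarrow> complex) set" where
  "C_closed_disc =
     {\<phi> \<in> Linf. \<exists>c. continuous_on (cball 0 1) c \<and> (AE z in dA. \<phi> z = c z)}"

definition A1_perp_plus_C :: "(complex \<Rightarrow> complex) set" where
  "A1_perp_plus_C = {\<lambda>z. \<psi> z + \<phi> z | \<psi> \<phi>. \<psi> \<in> A1_perp \<and> \<phi> \<in> C_closed_disc}"

lemma space_dA [simp]: "space dA = ball 0 1"
  by (simp add: dA_def space_scale_measure space_restrict_space)

lemma emeasure_dA_disc: "emeasure dA (ball 0 1) = 1"
proof -
  have "emeasure (lebesgue_on (ball 0 1)) (ball 0 1 :: complex set) = ennreal pi"
    by (simp add: emeasure_restrict_space emeasure_ball unit_ball_vol_2)
  then show ?thesis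
    by (simp add: dA_def ennreal_mult[symmetric])
qed

lemma A1_perp_cong_AE:
  assumes "\<psi> \<in> A1_perp" "h \<in> borel_measurable dA" "AE z in dA. h z = \<psi> z"
  shows "h \<in> A1_perp"
proof -
  from assms obtain B where m: "\<psi> \<in> borel_measurable dA" and B: "AE z in dA. norm (\<psi> z) \<le> B"
    by (auto simp: A1_perp_def Linf_def)
  have "AE z in dA. norm (h z) \<le> B"
    using assms(3) B by eventually_elim simp
  then have "h \<in> Linf" using assms(2) by (auto simp: Linf_def)
  moreover have "(LINT z|dA. f z * cnj (h z)) = 0" if f: "f \<in> bergman_A1" for f
  proof -
    have fm: "f \<in> borel_measurable dA" using f by (auto simp: bergman_A1_def)
    have cm: "cnj \<in> borel_measurable borel"
      by (intro borel_measurable_continuous_onI continuous_intros)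
    have "(LINT z|dA. f z * cnj (h z)) = (LINT z|dA. f z * cnj (\<psi> z))"
    proof (rule integral_cong_AE)
      show "(\<lambda>z. f z * cnj (h z)) \<in> borel_measurable dA"
        using fm measurable_compose[OF assms(2) cm] by (rule borel_measurable_times)
      show "(\<lambda>z. f z * cnj (\<psi> z)) \<in> borel_measurable dA"
        using fm measurable_compose[OF m cm] by (rule borel_measurable_times)
      show "AE z in dA. f z * cnj (h z) = f z * cnj (\<psi> z)"
        using assms(3) by eventually_elim simp
    qed
    then show ?thesis using f assms(1) by (auto simp: A1_perp_def)
  qed
  ultimately show ?thesis by (auto simp: A1_perp_def)
qed

lemma A1_perp_plus_C_cong_AE:
  assumes "g \<in> A1_perp_plus_C" "h \<in> borel_measurable dA" "AE z in dA. h z = g z"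
  shows "h \<in> A1_perp_plus_C"
proof -
  from assms(1) obtain \<psi> \<phi> where g: "g = (\<lambda>z. \<psi> z + \<phi> z)"
    and \<psi>: "\<psi> \<in> A1_perp" and \<phi>: "\<phi> \<in> C_closed_disc"
    by (auto simp: A1_perp_plus_C_def)
  have "\<phi> \<in> borel_measurable dA"
    using \<phi> by (auto simp: C_closed_disc_def Linf_def)
  then have "(\<lambda>z. h z - \<phi> z) \<in> borel_measurable dA"
    using assms(2) by (rule borel_measurable_diff[rotated])
  moreover have "AE z in dA. h z - \<phi> z = \<psi> z"
    using assms(3) by eventually_elim (simp add: g)
  ultimately have "(\<lambda>z. h z - \<phi> z) \<in> A1_perp"
    by (rule A1_perp_cong_AE[OF \<psi>])
  then show ?thesis
    unfolding A1_perp_plus_C_def using \<phi>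
    by (intro CollectI exI[of _ "\<lambda>z. h z - \<phi> z"] exI[of _ \<phi>]) simp
qed

end

theory Submission
  imports Defs "HOL-Complex_Analysis.Cauchy_Integral_Formula"
begin

text \<open>
  On the disc let \<open>g\<close> equal \<open>\<plusminus> z ^ (N - 1)\<close> on the annuli \<open>1/4 \<le> |z| ^ (2 * N) < 1/2\<close> (sign \<open>+\<close>) and
  \<open>1/2 \<le> |z| ^ (2 * N) < 3/4\<close> (sign \<open>-\<close>), for \<open>N = 5 ^ k\<close> and all \<open>k\<close>, and \<open>0\<close> elsewhere.
  Expanding a function of the Bergman space in its Taylor series on each pair of annuli, all terms
  but the one of degree \<open>N - 1\<close> integrate to \<open>0\<close> against \<open>g\<close> by rotation, and that one does so because
  the two annuli have equal weight \<open>\<integral> |z| ^ (2 * N - 2) dA\<close>; hence \<open>g\<close> lies in the annihilator.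
  In \<open>g\<^sup>2\<close> the signs disappear, and \<open>\<integral> z ^ (2 * N - 2) * cnj (g\<^sup>2) dA \<ge> 1 / (8 * N)\<close>. If \<open>g\<^sup>2\<close> were the
  sum of an element of the annihilator and a continuous function \<open>c\<close>, the same integral with \<open>c\<close>
  in place of \<open>g\<^sup>2\<close> would be \<open>o(1 / N)\<close> by a Riemann-Lebesgue argument.
\<close>

subsection \<open>Rotations and radial integrals\<close>

text \<open>
  Uniqueness of Haar measure by hand: for a translation invariant measure \<open>\<mu>\<close>, Fubini's theorem gives
  \<open>\<mu> A * lborel B = lborel A * \<mu> (- B)\<close>. Take for \<open>B\<close> the unit disc, which is symmetric and
  invariant under the rotation.
\<close>

lemma distr_lborel_rotation:
  fixes w :: complex
  assumes w: "norm w = 1"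
  shows "distr lborel borel ((*) w) = lborel"
proof (rule measure_eqI)
  fix A :: "complex set" assume "A \<in> sets (distr lborel borel ((*) w))"
  then have A [measurable]: "A \<in> sets borel" by simp
  define B :: "complex set" where "B = ball 0 1"
  have B [measurable]: "B \<in> sets borel" by (simp add: B_def)
  have wB: "w * x \<in> B \<longleftrightarrow> x \<in> B" "- x \<in> B \<longleftrightarrow> x \<in> B" for x
    using w by (simp_all add: B_def norm_mult)
  have shift: "(\<integral>\<^sup>+x. g (c + x) \<partial>lborel) = (\<integral>\<^sup>+x. g x \<partial>lborel)"
    if [measurable]: "g \<in> borel_measurable borel" for g :: "complex \<Rightarrow> ennreal" and c
    by (subst (2) lborel_distr_plus[symmetric, of c]) (simp add: nn_integral_distr)
  have "emeasure (distr lborel borel ((*) w)) A * emeasure lborel B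
      = (\<integral>\<^sup>+y. indicator B y * (\<integral>\<^sup>+x. indicator A (w * x) \<partial>lborel) \<partial>lborel)"
  proof -
    have "emeasure (distr lborel borel ((*) w)) A = (\<integral>\<^sup>+x. indicator A x \<partial>distr lborel borel ((*) w))"
      by simp
    also have "\<dots> = (\<integral>\<^sup>+x. indicator A (w * x) \<partial>lborel)"
      by (subst nn_integral_distr) simp_all
    finally show ?thesis
      by (simp add: nn_integral_multc mult.commute)
  qed
  also have "\<dots> = (\<integral>\<^sup>+y. (\<integral>\<^sup>+x. indicator B y * indicator A (y + w * x) \<partial>lborel) \<partial>lborel)"
  proof (rule nn_integral_cong)
    fix y :: complex
    \<comment> \<open>Translating by \<open>y\<close> after the rotation amounts to rotating a
      translate by \<open>y / w\<close>, so the inner integral over \<open>x\<close> does not depend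
      on \<open>y\<close>.\<close>
    have "y = w * (y / w)" using w by (auto simp: field_simps)
    then have "indicator A (y + w * x) = (indicator A (w * (y / w + x)) :: ennreal)" for x
      by (metis distrib_left)
    then have "(\<integral>\<^sup>+x. indicator A (y + w * x) \<partial>lborel) = (\<integral>\<^sup>+x. indicator A (w * (y / w + x)) \<partial>lborel :: ennreal)"
      by simp
    also have "\<dots> = (\<integral>\<^sup>+x. indicator A (w * x) \<partial>lborel)"
      by (rule shift) simp
    finally show "indicator B y * (\<integral>\<^sup>+x. indicator A (w * x) \<partial>lborel)
        = (\<integral>\<^sup>+x. indicator B y * indicator A (y + w * x) \<partial>lborel)"
      by (simp add: nn_integral_cmult)
  qed
  also have "\<dots> = (\<integral>\<^sup>+x. (\<integral>\<^sup>+y. indicator B y * indicator A (y + w * x) \<partial>lborel) \<partial>lborel)"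
    by (rule lborel_pair.Fubini') measurable
  also have "\<dots> = (\<integral>\<^sup>+x. (\<integral>\<^sup>+y. indicator B (y - w * x) * indicator A y \<partial>lborel) \<partial>lborel)"
  proof (rule nn_integral_cong)
    fix x :: complex
    have "(\<integral>\<^sup>+y. indicator B (y - w * x) * indicator A y \<partial>lborel :: ennreal)
        = (\<integral>\<^sup>+y. indicator B ((w * x + y) - w * x) * indicator A (w * x + y) \<partial>lborel)"
      by (rule shift[symmetric]) simp
    then show "(\<integral>\<^sup>+y. indicator B y * indicator A (y + w * x) \<partial>lborel)
        = (\<integral>\<^sup>+y. indicator B (y - w * x) * indicator A y \<partial>lborel :: ennreal)"
      by (simp add: add.commute)
  qed
  also have "\<dots> = (\<integral>\<^sup>+y. (\<integral>\<^sup>+x. indicator B (y - w * x) * indicator A y \<partial>lborel) \<partial>lborel)"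
    by (rule lborel_pair.Fubini') measurable
  also have "\<dots> = (\<integral>\<^sup>+y. emeasure lborel B * indicator A y \<partial>lborel)"
  proof (rule nn_integral_cong)
    fix y :: complex
    \<comment> \<open>The symmetries of \<open>B\<close> turn this into the indicator of a translate
      of \<open>B\<close>, whose volume does not depend on \<open>y\<close>.\<close>
    have "indicator B (y - w * x) = (indicator B (- (y / w) + x) :: ennreal)" for x
    proof -
      have "y - w * x = w * - (- (y / w) + x)" using w by (auto simp: field_simps)
      then show ?thesis by (simp only: indicator_def wB)
    qed
    then have "(\<integral>\<^sup>+x. indicator B (y - w * x) \<partial>lborel :: ennreal) = (\<integral>\<^sup>+x. indicator B (- (y / w) + x) \<partial>lborel)"
      by simp
    also have "\<dots> = (\<integral>\<^sup>+x. indicator B x \<partial>lborel)"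
      by (rule shift) simp
    finally show "(\<integral>\<^sup>+x. indicator B (y - w * x) * indicator A y \<partial>lborel) = emeasure lborel B * (indicator A y :: ennreal)"
      by (simp add: nn_integral_multc)
  qed
  also have "\<dots> = emeasure lborel A * emeasure lborel B"
    by (subst nn_integral_cmult) (simp_all add: mult.commute)
  finally have "emeasure lborel B * emeasure (distr lborel borel ((*) w)) A = emeasure lborel B * emeasure lborel A"
    by (simp only: mult.commute)
  \<comment> \<open>The factor \<open>emeasure lborel B\<close> may be cancelled, being neither 0
    nor infinite.\<close>
  moreover have "emeasure lborel B = ennreal pi"
    by (simp add: B_def emeasure_ball unit_ball_vol_2)
  ultimately show "emeasure (distr lborel borel ((*) w)) A = emeasure lborel A"
    by (simp add: ennreal_mult_cancel_left)
qed simp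

section \<open>The normalized measure \<open>dA\<close> under rotations and in the radial
  variable\<close>

lemma borel_measurable_dA: "f \<in> borel_measurable borel \<Longrightarrow> f \<in> borel_measurable dA"
  by (subst measurable_cong_sets[where M'="lebesgue_on (ball 0 1)" and N'=borel])
    (auto simp: dA_def intro!: measurable_restrict_space1 measurable_completion)

lemma measurable_ident_dA [measurable]: "(\<lambda>z. z) \<in> measurable dA borel"
  by (rule borel_measurable_dA) simp

lemma emeasure_dA_borel:
  assumes "A \<in> sets borel"
  shows "emeasure dA (A \<inter> ball 0 1) = ennreal (1 / pi) * emeasure lborel (A \<inter> ball 0 1)"
  using assms by (simp add: dA_def emeasure_restrict_space)

interpretation dA: finite_measure dA
  by (rule finite_measureI) (simp add: emeasure_dA_disc)

text \<open>Lebesgue measure and the disc are rotation invariant, so \<open>dA\<close> has the same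
  image on the Borel sets under multiplication by \<open>w\<close> and under the identity. The
  identity image serves to pass from the completed sigma-algebra of \<open>dA\<close> to the Borel
  sets.\<close>

lemma integral_dA_rotation:
  fixes F :: "complex \<Rightarrow> complex"
  assumes w: "norm w = 1" and F: "F \<in> borel_measurable borel"
  shows "(LINT z|dA. F (w * z)) = (LINT z|dA. F z)"
proof -
  have "distr dA borel ((*) w) = distr dA borel (\<lambda>z. z)"
  proof (rule measure_eqI)
    fix A :: "complex set" assume "A \<in> sets (distr dA borel ((*) w))"
    then have A [measurable]: "A \<in> sets borel" by simp
    let ?A = "A \<inter> ball 0 1"
    have eq: "(*) w -` ?A = ((*) w -` A) \<inter> ball 0 1" using w by (auto simp: norm_mult)
    have m: "(*) w -` A \<in> sets borel"
      using measurable_sets[of "(*) w" borel borel A] by simp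
    have "emeasure (distr dA borel ((*) w)) A = emeasure dA (((*) w -` A) \<inter> ball 0 1)"
      by (subst emeasure_distr) auto
    also have "\<dots> = ennreal (1 / pi) * emeasure lborel ((*) w -` ?A)"
      unfolding eq by (rule emeasure_dA_borel[OF m])
    also have "emeasure lborel ((*) w -` ?A) = emeasure (distr lborel borel ((*) w)) ?A"
      by (subst emeasure_distr) auto
    also have "\<dots> = emeasure lborel ?A" by (simp add: distr_lborel_rotation[OF w])
    also have "ennreal (1 / pi) * \<dots> = emeasure dA ?A" by (rule emeasure_dA_borel[symmetric]) simp
    also have "\<dots> = emeasure (distr dA borel (\<lambda>z. z)) A"
      by (subst emeasure_distr) (auto simp: Int_commute)
    finally show "emeasure (distr dA borel ((*) w)) A = emeasure (distr dA borel (\<lambda>z. z)) A" .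
  qed simp
  then have "integral\<^sup>L (distr dA borel ((*) w)) F = integral\<^sup>L (distr dA borel (\<lambda>z. z)) F" by simp
  then show ?thesis
    using F by (simp add: integral_distr)
qed

text \<open>A disc of radius \<open>sqrt x\<close> has normalized area \<open>x\<close> for
  \<open>0 \<le> x \<le> 1\<close>, so |z|^2 is uniformly distributed. This takes the place of polar
  coordinates; comparing open rays is enough to identify the measures.\<close>

lemma distr_dA_norm_square:
  "distr dA borel (\<lambda>z. (norm z)\<^sup>2) = density lborel (indicator {0..1})" (is "?L = ?R")
proof (rule measure_eqI_lessThan)
  have nm [measurable]: "(\<lambda>z. (norm z)\<^sup>2) \<in> borel_measurable dA"
    by (rule borel_measurable_dA) simp
  interpret L: finite_measure ?L by (rule dA.finite_measure_distr) simp
  show "emeasure ?L {x<..} < \<infinity>" for x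
    using L.emeasure_finite[of "{x<..}"] by (simp only: infinity_ennreal_def less_top)
  show "emeasure ?L {x<..} = emeasure ?R {x<..}" for x :: real
  proof -
    \<comment> \<open>\<open>sqrt\<close> is increasing on the whole real line in HOL, so negative
      \<open>x\<close> is covered too.\<close>
    have sq: "x < (norm z)\<^sup>2 \<longleftrightarrow> sqrt x < norm z" for z :: complex
      by (metis abs_norm_cancel real_sqrt_abs real_sqrt_less_iff)
    have m: "emeasure ?L {x<..} = emeasure dA ({z. x < (norm z)\<^sup>2} \<inter> ball 0 1)"
      by (subst emeasure_distr) (auto intro!: arg_cong[where f="emeasure dA"])
    have "emeasure ?R {x<..} = (\<integral>\<^sup>+t. indicator ({0..1} \<inter> {x<..}) t \<partial>lborel)"
      by (subst emeasure_density) (auto intro!: nn_integral_cong simp del: nn_integral_indicator split: split_indicator)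
    then have R: "emeasure ?R {x<..} = emeasure lborel ({0..1} \<inter> {x<..})"
      by (simp only: nn_integral_indicator sets_lborel sets.Int atLeastAtMost_borel greaterThan_borel)
    consider "x < 0" | "0 \<le> x" "x < 1" | "1 \<le> x" by linarith
    then show ?thesis
    proof cases
      case 1
      then have "{z::complex. x < (norm z)\<^sup>2} \<inter> ball 0 1 = ball 0 1"
        using less_le_trans[OF 1 zero_le_power2] by auto
      moreover have "{0..1} \<inter> {x<..} = {0..1}" using 1 by auto
      ultimately show ?thesis by (simp add: m R emeasure_dA_disc)
    next
      case 2
      have lt1: "sqrt x < 1" using 2 by simp
      have set_eq: "{z::complex. x < (norm z)\<^sup>2} \<inter> ball 0 1 = ball 0 1 - cball 0 (sqrt x)"
        by (auto simp: sq not_le)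
      then have "emeasure ?L {x<..} = ennreal (1 / pi) * emeasure lborel (ball 0 1 - cball (0::complex) (sqrt x))"
        unfolding m using emeasure_dA_borel[of "ball 0 1 - cball 0 (sqrt x)"] by (simp add: set_eq Int_absorb2 Diff_subset)
      also have "emeasure lborel (ball 0 1 - cball (0::complex) (sqrt x)) = emeasure lborel (ball (0::complex) 1) - emeasure lborel (cball (0::complex) (sqrt x))"
        using 2 by (intro emeasure_Diff) (auto simp: emeasure_cball intro: le_less_trans[OF _ lt1])
      also have "\<dots> = ennreal (pi * (1 - x))"
        using 2 by (simp add: emeasure_cball emeasure_ball unit_ball_vol_2 ennreal_minus algebra_simps)
      also have "ennreal (1 / pi) * \<dots> = ennreal (1 - x)"
        using 2 by (simp add: ennreal_mult[symmetric])
      also have "{0..1} \<inter> {x<..} = {x<..1}" using 2 by auto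
      then have "ennreal (1 - x) = emeasure ?R {x<..}" using 2 R by simp
      finally show ?thesis .
    next
      case 3
      then have "{z::complex. x < (norm z)\<^sup>2} \<inter> ball 0 1 = {}"
      proof -
        have "norm z < 1 \<Longrightarrow> \<not> sqrt x < norm z" for z :: complex
          using real_sqrt_ge_1_iff[of x] 3 by linarith
        then show ?thesis by (auto simp: sq)
      qed
      moreover have "{0..1} \<inter> {x<..} = {}" using 3 by auto
      ultimately show ?thesis by (simp add: m R)
    qed
  qed
qed simp_all

text \<open>With t = |z|^2 the integrand is \<open>t ^ (N - 1)\<close> on a \<le> t^N < b, with
  antiderivative t^N / N. Annuli cut out by |z|^(2N) thus have weight proportional to the length
  \<open>b - a\<close>.\<close>

lemma integral_dA_norm_power_annulus:
  assumes ab: "0 \<le> a" "a \<le> b" "b \<le> 1" and N: "N > 0"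
  shows "(LINT z|dA. indicator {a..<b} (norm z ^ (2 * N)) * norm z ^ (2 * (N - 1))) = (b - a) / N"
proof -
  define \<alpha> \<beta> where "\<alpha> = root N a" and "\<beta> = root N b"
  have \<alpha>: "0 \<le> \<alpha>" "\<alpha> ^ N = a" and \<beta>: "0 \<le> \<beta>" "\<beta> ^ N = b" and \<alpha>\<beta>: "\<alpha> \<le> \<beta>" "\<beta> \<le> 1"
    using ab N by (auto simp: \<alpha>_def \<beta>_def)
  have iff: "t ^ N \<in> {a..<b} \<longleftrightarrow> t \<in> {\<alpha>..<\<beta>}" if "0 \<le> t" for t
    using power_mono_iff[of \<alpha> t N] power_mono_iff[of \<beta> t N] \<alpha> \<beta> N that
    by (metis atLeastLessThan_iff not_le)
  have "(LINT z|dA. indicator {a..<b} (norm z ^ (2 * N)) * norm z ^ (2 * (N - 1)))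
      = (LINT z|dA. (\<lambda>t. indicator {a..<b} (t ^ N) * t ^ (N - 1)) ((norm z)\<^sup>2))"
    by (simp add: power_mult)
  also have "\<dots> = (LINT t|distr dA borel (\<lambda>z. (norm z)\<^sup>2). indicator {a..<b} (t ^ N) * t ^ (N - 1))"
    by (rule integral_distr[symmetric]) simp_all
  also have "\<dots> = (LINT t|density lborel (\<lambda>t. ennreal (indicator {0..1} t)). indicator {a..<b} (t ^ N) * t ^ (N - 1))"
    by (simp add: distr_dA_norm_square ennreal_indicator)
  also have "\<dots> = (LINT t|lborel. indicator {0..1} t * (indicator {a..<b} (t ^ N) * t ^ (N - 1)))"
    by (subst integral_real_density) auto
  \<comment> \<open>\<open>\<beta> \<le> 1\<close> keeps the interval inside \<open>{0..1}\<close>,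
    whose indicator also removes negative \<open>t\<close> with \<open>t ^ N\<close> in range.
    Closing the interval at \<open>\<beta>\<close> adds a null set.\<close>
  also have "\<dots> = (LINT t|lborel. t ^ (N - 1) * indicator {\<alpha>..\<beta>} t)"
  proof (rule integral_cong_AE)
    have "AE t in lborel. t \<noteq> \<beta>" by (rule AE_lborel_singleton)
    then show "AE t in lborel. indicator {0..1} t * (indicator {a..<b} (t ^ N) * t ^ (N - 1))
        = t ^ (N - 1) * indicator {\<alpha>..\<beta>} t"
    proof eventually_elim
      case (elim t)
      show ?case
        using iff[of t] elim \<alpha> \<alpha>\<beta> by (cases "0 \<le> t") (auto simp: indicator_def)
    qed
  qed simp_all
  also have "\<dots> = (b - a) / N"
    using integral_power[OF \<alpha>\<beta>(1), of "N - 1"] N \<alpha> \<beta> by simp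
  finally show ?thesis .
qed

subsection \<open>Pairings with powers and with holomorphic functions\<close>

lemma borel_measurable_cnj [measurable (raw)]:
  "f \<in> borel_measurable M \<Longrightarrow> (\<lambda>x. cnj (f x)) \<in> borel_measurable M"
  by (rule borel_measurable_continuous_on[OF _]) (auto intro: continuous_intros)

text \<open>The rotation by pi / (n - m) leaves \<open>s (norm z)\<close> unchanged and multiplies
  the integrand by cis pi = -1, so the integral is its own negative.\<close>

lemma integral_monomials_radial_eq_0:
  fixes s :: "real \<Rightarrow> real"
  assumes s [measurable]: "s \<in> borel_measurable borel" and nm: "n \<noteq> m"
  shows "(LINT z|dA. z ^ n * cnj (of_real (s (norm z)) * z ^ m)) = 0"
proof -
  let ?F = "\<lambda>z::complex. z ^ n * cnj (of_real (s (norm z)) * z ^ m)"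
  define \<alpha> where "\<alpha> = pi / (real n - real m)"
  have half: "cis \<alpha> ^ n * cnj (cis \<alpha> ^ m) = -1"
  proof -
    have "cis \<alpha> ^ n * cnj (cis \<alpha> ^ m) = cis (real n * \<alpha> - real m * \<alpha>)"
      by (simp add: Complex.DeMoivre cis_mult cis_cnj)
    also have "real n * \<alpha> - real m * \<alpha> = pi"
      using nm by (simp add: \<alpha>_def diff_divide_distrib[symmetric] left_diff_distrib[symmetric])
    finally show ?thesis by simp
  qed
  have "?F (cis \<alpha> * z) = (cis \<alpha> ^ n * cnj (cis \<alpha> ^ m)) * ?F z" for z
    by (simp add: norm_mult power_mult_distrib)
  then have F: "?F (cis \<alpha> * z) = - ?F z" for z
    by (simp only: half) simp
  \<comment> \<open>This equation and the next hold also for a non-integrable integrand, whose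
    integral is 0 by convention.\<close>
  have "(LINT z|dA. ?F z) = (LINT z|dA. ?F (cis \<alpha> * z))"
    by (rule integral_dA_rotation[symmetric]) simp_all
  also have "\<dots> = - (LINT z|dA. ?F z)"
    by (simp only: F integral_minus)
  finally show ?thesis
    by simp
qed

text \<open>The rotation by \<open>\<pi> / n\<close> flips the sign of \<open>z ^ n\<close> but hardly changes \<open>c\<close>.\<close>

lemma Riemann_Lebesgue_disc:
  fixes c :: "complex \<Rightarrow> complex"
  assumes c: "continuous_on (cball 0 1) c" and e: "e > 0"
  obtains n0 where "\<And>n. n \<ge> n0 \<Longrightarrow> norm (LINT z|dA. z ^ n * cnj (c z)) \<le> e * (LINT z|dA. norm z ^ n)"
proof -
  have "uniformly_continuous_on (cball 0 1) c"
    using c by (rule compact_uniformly_continuous) simp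
  then obtain d where d: "d > 0"
    "\<And>x y. x \<in> cball 0 1 \<Longrightarrow> y \<in> cball 0 1 \<Longrightarrow> dist x y < d \<Longrightarrow> dist (c x) (c y) < e"
    using e unfolding uniformly_continuous_on_def by metis
  have "isCont cis 0" unfolding cis_conv_exp by (intro continuous_intros)
  then have "((\<lambda>n. cis (pi / real n)) \<longlongrightarrow> cis 0) sequentially"
    by (rule isCont_tendsto_compose) real_asymp
  then have "\<forall>\<^sub>F n in sequentially. dist (cis (pi / real n)) (cis 0) < d"
    using d(1) by (rule tendstoD)
  then obtain n1 where n1: "\<And>n. n \<ge> n1 \<Longrightarrow> dist (cis (pi / real n)) 1 < d"
    by (auto simp: eventually_sequentially)
  \<comment> \<open>Cutting \<open>c\<close> off outside the disc gives a function that is Borel on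
    the whole plane, as \<open>integral_dA_rotation\<close> demands.\<close>
  define C where "C = (\<lambda>z. indicator (ball 0 1) z *\<^sub>R c z)"
  have C [measurable]: "C \<in> borel_measurable borel"
    unfolding C_def by (rule borel_measurable_continuous_on_indicator) (auto intro: continuous_on_subset[OF c])
  have "bounded (c ` cball 0 1)"
    using c by (intro compact_imp_bounded compact_continuous_image) simp_all
  then obtain B where B: "\<And>z. z \<in> cball 0 1 \<Longrightarrow> norm (c z) \<le> B"
    unfolding bounded_iff by blast
  have B0: "0 \<le> B" using B[of 0] norm_ge_zero[of "c 0"] by simp (meson order_trans norm_ge_zero)
  have Cbound: "norm (C z) \<le> B" for z
    using B[of z] B0 by (simp add: C_def indicator_def)
  \<comment> \<open>The maximum excludes \<open>n = 0\<close>, where division by zero would make the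
    angle 0 and \<open>w = 1\<close>.\<close>
  have "norm (LINT z|dA. z ^ n * cnj (c z)) \<le> e * (LINT z|dA. norm z ^ n)" if n: "n \<ge> max 1 n1" for n
  proof -
    define w where "w = cis (pi / real n)"
    let ?F = "\<lambda>z. z ^ n * cnj (C z)"
    \<comment> \<open>As \<open>w ^ n = -1\<close>, this is \<open>?F z + ?F (w * z)\<close>, so its
      integral is twice that of \<open>?F\<close>, while its size is controlled by the small
      displacement from \<open>z\<close> to \<open>w * z\<close>.\<close>
    let ?G = "\<lambda>z. z ^ n * cnj (C z - C (w * z))"
    have w: "norm w = 1" "w ^ n = -1"
      using n by (simp_all add: w_def Complex.DeMoivre)
    have F: "integrable dA ?F"
    proof (rule dA.integrable_const_bound)
      show "AE z in dA. norm (?F z) \<le> B"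
      proof (rule AE_I2)
        fix z assume "z \<in> space dA"
        then have "norm z ^ n * norm (C z) \<le> 1 * B"
          using Cbound[of z] by (intro mult_mono power_le_one) auto
        then show "norm (?F z) \<le> B" by (simp add: norm_mult norm_power)
      qed
      show "?F \<in> borel_measurable dA" by (rule borel_measurable_dA) measurable
    qed
    have G: "integrable dA ?G"
    proof (rule dA.integrable_const_bound)
      show "AE z in dA. norm (?G z) \<le> 2 * B"
      proof (rule AE_I2)
        fix z assume "z \<in> space dA"
        moreover have "norm (C z - C (w * z)) \<le> 2 * B"
          using norm_triangle_ineq4[of "C z" "C (w * z)"] Cbound[of z] Cbound[of "w * z"] by linarith
        ultimately have "norm z ^ n * norm (C z - C (w * z)) \<le> 1 * (2 * B)"
          by (intro mult_mono power_le_one) auto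
        then show "norm (?G z) \<le> 2 * B" by (simp add: norm_mult norm_power flip: complex_cnj_diff)
      qed
      show "?G \<in> borel_measurable dA" by (rule borel_measurable_dA) measurable
    qed
    have P: "integrable dA (\<lambda>z. norm z ^ n)"
    proof (rule dA.integrable_const_bound)
      show "AE z in dA. norm (norm z ^ n) \<le> 1"
        by (rule AE_I2) (simp add: power_le_one)
      show "(\<lambda>z. norm z ^ n) \<in> borel_measurable dA" by (rule borel_measurable_dA) measurable
    qed
    have eq: "(LINT z|dA. z ^ n * cnj (c z)) = (LINT z|dA. ?F z)"
      by (rule Bochner_Integration.integral_cong) (auto simp: C_def)
    have "?G z = ?F z + ?F (w * z)" for z
      by (simp add: power_mult_distrib w algebra_simps)
    moreover have "(LINT z|dA. ?F (w * z)) = (LINT z|dA. ?F z)"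
      by (rule integral_dA_rotation) (simp_all add: w)
    moreover have "integrable dA (\<lambda>z. ?F (w * z))"
    proof -
      have "(\<lambda>z. ?F (w * z)) = (\<lambda>z. ?G z - ?F z)"
        by (rule ext) (simp add: power_mult_distrib w algebra_simps)
      then show ?thesis using F G by simp
    qed
    ultimately have "(LINT z|dA. ?G z) = 2 * (LINT z|dA. ?F z)"
      using F by simp
    then have "2 * norm (LINT z|dA. ?F z) = norm (LINT z|dA. ?G z)"
      by (simp add: norm_mult)
    also have "\<dots> \<le> (LINT z|dA. norm (?G z))"
      by (rule integral_norm_bound)
    also have "\<dots> \<le> (LINT z|dA. e * norm z ^ n)"
    proof (rule integral_mono)
      show "integrable dA (\<lambda>z. norm (?G z))" using G by (rule integrable_norm)
      show "integrable dA (\<lambda>z. e * norm z ^ n)" using P by simp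
      fix z assume z: "z \<in> space dA"
      then have wz: "w * z \<in> ball 0 1" using w by (simp add: norm_mult)
      have "dist z (w * z) = norm (1 - w) * norm z"
        by (simp add: dist_norm norm_mult[symmetric] algebra_simps)
      also have "\<dots> \<le> norm (1 - w) * 1" using z by (intro mult_left_mono) auto
      also have "\<dots> < d" using n1[of n] n by (simp add: w_def dist_norm norm_minus_commute)
      finally have "dist (c z) (c (w * z)) < e" using z wz by (intro d) auto
      then have "norm (C z - C (w * z)) \<le> e" using z wz by (simp add: C_def dist_norm)
      then have "norm z ^ n * norm (C z - C (w * z)) \<le> norm z ^ n * e"
        by (intro mult_left_mono) auto
      then show "norm (?G z) \<le> e * norm z ^ n"
        by (simp add: norm_mult norm_power mult.commute flip: complex_cnj_diff)
    qed
    also have "\<dots> = e * (LINT z|dA. norm z ^ n)" by simp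
    finally have "2 * norm (LINT z|dA. ?F z) \<le> e * (LINT z|dA. norm z ^ n)" .
    then show ?thesis
      unfolding eq using norm_ge_zero[of "LINT z|dA. ?F z"] by linarith
  qed
  then show ?thesis by (rule that)
qed

text \<open>The factor \<open>s (norm z)\<close> confines the integral to |z| < \<rho>, where the
  Taylor series of \<open>h\<close> is dominated by a convergent series of constants and may be
  integrated termwise. The terms of degree n \<noteq> m vanish by rotation, the term of degree m by
  \<open>mean\<close>.\<close>

lemma integral_holomorphic_radial:
  fixes s :: "real \<Rightarrow> real"
  assumes h: "h holomorphic_on ball 0 1"
    and s [measurable]: "s \<in> borel_measurable borel"
    and bd: "\<And>r. \<bar>s r\<bar> \<le> 1" and \<rho>: "0 < \<rho>" "\<rho> < 1" and supp: "\<And>r. r \<ge> \<rho> \<Longrightarrow> s r = 0"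
    and mean: "(LINT z|dA. s (norm z) * norm z ^ (2 * m)) = 0"
  shows "(LINT z|dA. h z * cnj (of_real (s (norm z)) * z ^ m)) = 0"
proof -
  define a where "a = (\<lambda>n. (deriv ^^ n) h 0 / fact n)"
  have a: "(\<lambda>n. a n * z ^ n) sums h z" if "norm z < 1" for z
    using holomorphic_power_series[OF h, of z] that by (simp add: a_def)
  let ?u = "\<lambda>z::complex. of_real (s (norm z)) * z ^ m"
  \<comment> \<open>Convergence at the midpoint of \<open>\<rho>\<close> and 1, still inside the
    disc, gives absolute convergence at \<open>\<rho>\<close>.\<close>
  have "summable (\<lambda>n. norm (a n * (of_real \<rho>) ^ n))"
  proof (rule powser_insidea)
    show "summable (\<lambda>n. a n * (of_real ((1 + \<rho>) / 2)) ^ n)"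
      using a[of "of_real ((1 + \<rho>) / 2)"] \<rho> by (simp add: sums_iff norm_divide del: of_real_divide of_real_add)
    show "norm (of_real \<rho> :: complex) < norm (of_real ((1 + \<rho>) / 2) :: complex)"
      using \<rho> by (simp del: of_real_divide of_real_add)
  qed
  then have sum\<rho>: "summable (\<lambda>n. norm (a n) * \<rho> ^ n)"
    using \<rho> by (simp add: norm_mult norm_power)
  have bound: "norm (a n * z ^ n * cnj (?u z)) \<le> norm (a n) * \<rho> ^ n" if "norm z < 1" for n z
  proof (cases "norm z \<ge> \<rho>")
    case True
    then show ?thesis using supp \<rho> by simp
  next
    case False
    have "\<bar>s (norm z)\<bar> * norm z ^ m \<le> 1 * 1"
      using bd that by (intro mult_mono power_le_one) auto
    then have "norm (a n) * norm z ^ n * (\<bar>s (norm z)\<bar> * norm z ^ m) \<le> norm (a n) * \<rho> ^ n * 1"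
      using False \<rho> by (intro mult_mono power_mono) auto
    then show ?thesis by (simp add: norm_mult norm_power)
  qed
  have term0: "(LINT z|dA. a n * z ^ n * cnj (?u z)) = 0" for n
  proof (cases "n = m")
    case False
    then have "(LINT z|dA. a n * (z ^ n * cnj (?u z))) = 0"
      by (subst integral_mult_right_zero) (simp add: integral_monomials_radial_eq_0[OF s, simplified])
    then show ?thesis by (simp add: mult.assoc)
  next
    case True
    have "z ^ m * cnj (?u z) = of_real (s (norm z) * norm z ^ (2 * m))" for z :: complex
    proof -
      have "z ^ m * cnj z ^ m = of_real (norm z ^ (2 * m))"
        by (simp add: power_mult_distrib[symmetric] complex_norm_square[symmetric] power_mult)
      then show ?thesis by simp
    qed
    then have "(LINT z|dA. z ^ m * cnj (?u z)) = of_real (LINT z|dA. s (norm z) * norm z ^ (2 * m))"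
      by (simp only: integral_complex_of_real)
    then have "(LINT z|dA. a n * (z ^ n * cnj (?u z))) = 0"
      using True mean by (subst integral_mult_right_zero) simp
    then show ?thesis by (simp add: mult.assoc)
  qed
  have int: "integrable dA (\<lambda>z. a n * z ^ n * cnj (?u z))" for n
  proof (rule dA.integrable_const_bound)
    show "AE z in dA. norm (a n * z ^ n * cnj (?u z)) \<le> norm (a n) * \<rho> ^ n"
      by (rule AE_I2) (rule bound, simp)
    show "(\<lambda>z. a n * z ^ n * cnj (?u z)) \<in> borel_measurable dA"
      by (rule borel_measurable_dA) measurable
  qed
  have "(\<lambda>n. LINT z|dA. a n * z ^ n * cnj (?u z)) sums (LINT z|dA. (\<Sum>n. a n * z ^ n * cnj (?u z)))"
  proof (rule sums_integral)
    show "AE z in dA. summable (\<lambda>n. norm (a n * z ^ n * cnj (?u z)))"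
    proof (rule AE_I2)
      fix z assume "z \<in> space dA"
      then have "norm z < 1" by simp
      then show "summable (\<lambda>n. norm (a n * z ^ n * cnj (?u z)))"
        by (intro summable_comparison_test'[OF sum\<rho>, of 0]) (simp only: real_norm_def abs_norm_cancel bound)
    qed
    show "summable (\<lambda>n. LINT z|dA. norm (a n * z ^ n * cnj (?u z)))"
    proof (rule summable_comparison_test'[of _ 0])
      show "summable (\<lambda>n. (norm (a n) * \<rho> ^ n) * measure dA (space dA))"
        using sum\<rho> by (rule summable_mult2)
      fix n
      have "(LINT z|dA. norm (a n * z ^ n * cnj (?u z))) \<le> (LINT z|dA. norm (a n) * \<rho> ^ n)"
        using int[of n] bound by (intro integral_mono) (auto simp del: norm_mult)
      then show "norm (LINT z|dA. norm (a n * z ^ n * cnj (?u z))) \<le> (norm (a n) * \<rho> ^ n) * measure dA (space dA)"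
        by (simp add: mult_ac)
    qed
  qed (rule int)
  then have "(LINT z|dA. (\<Sum>n. a n * z ^ n * cnj (?u z))) = 0"
    by (simp only: term0 sums_iff suminf_zero)
  moreover have "(LINT z|dA. (\<Sum>n. a n * z ^ n * cnj (?u z))) = (LINT z|dA. h z * cnj (?u z))"
  proof (rule Bochner_Integration.integral_cong)
    fix z assume "z \<in> space dA"
    then have "(\<lambda>n. a n * z ^ n * cnj (?u z)) sums (h z * cnj (?u z))"
      using a[of z] by (intro sums_mult2) simp
    then show "(\<Sum>n. a n * z ^ n * cnj (?u z)) = h z * cnj (?u z)"
      by (simp only: sums_iff)
  qed simp
  ultimately show ?thesis by simp
qed

subsection \<open>A lacunary series with disjoint annular supports\<close>

text \<open>Collapses the pointwise infinite sums below to one term; if all terms vanish, any index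
  serves and 0 is taken.\<close>

lemma disjoint_terms_cases:
  fixes x :: "nat \<Rightarrow> 'a::zero"
  assumes "\<And>j k. j \<noteq> k \<Longrightarrow> x j = 0 \<or> x k = 0"
  obtains k where "\<And>j. j \<noteq> k \<Longrightarrow> x j = 0"
proof (cases "\<exists>k. x k \<noteq> 0")
  case True
  then obtain k where "x k \<noteq> 0" by blast
  then show ?thesis using assms[of _ k] by (intro that[of k]) blast
next
  case False
  then show ?thesis by (intro that[of 0]) blast
qed

lemma disjoint_terms_sums:
  fixes x :: "nat \<Rightarrow> 'a::real_normed_vector"
  assumes "\<And>j k. j \<noteq> k \<Longrightarrow> x j = 0 \<or> x k = 0"
  shows "x sums (\<Sum>k. x k)"
proof -
  obtain k where "\<And>j. j \<noteq> k \<Longrightarrow> x j = 0"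
    using disjoint_terms_cases[of x, OF assms] by blast
  then have "x sums x k"
    using sums_finite[of "{k}" x] by simp
  then show ?thesis by (simp add: sums_iff)
qed

text \<open>At most one summand is nonzero, so partial sums inherit the bound of a single term with
  no factor \<open>n\<close>. This supplies the majorant for dominated convergence.\<close>

lemma disjoint_terms_sum_bound:
  fixes x :: "nat \<Rightarrow> 'a::real_normed_vector"
  assumes "\<And>j k. j \<noteq> k \<Longrightarrow> x j = 0 \<or> x k = 0" and B: "\<And>k. norm (x k) \<le> B"
  shows "norm (\<Sum>k<n. x k) \<le> B" "norm (\<Sum>k. x k) \<le> B"
proof -
  obtain k where k: "\<And>j. j \<noteq> k \<Longrightarrow> x j = 0"
    using disjoint_terms_cases[of x, OF assms(1)] by blast
  have "0 \<le> B" using B[of 0] norm_ge_zero order_trans by blast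
  show bd: "norm (\<Sum>k<n. x k) \<le> B" for n
  proof -
    have "(\<Sum>j<n. x j) = (\<Sum>j<n. if j = k then x k else 0)"
      by (rule sum.cong) (auto simp: k)
    then show ?thesis using B \<open>0 \<le> B\<close> by simp
  qed
  have "(\<lambda>n. \<Sum>k<n. x k) \<longlonglongrightarrow> (\<Sum>k. x k)"
    using disjoint_terms_sums[OF assms(1)] by (simp add: sums_def)
  then show "norm (\<Sum>k. x k) \<le> B"
    by (rule Lim_norm_ubound[OF sequentially_bot]) (simp add: bd)
qed

text \<open>The only term that can be nonzero multiplies itself, so there are no cross
  terms.\<close>

lemma disjoint_terms_suminf_square:
  fixes x :: "nat \<Rightarrow> 'a::real_normed_algebra"
  assumes "\<And>j k. j \<noteq> k \<Longrightarrow> x j = 0 \<or> x k = 0"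
  shows "(\<Sum>k. x k) * (\<Sum>k. x k) = (\<Sum>k. x k * x k)"
proof -
  obtain k where k: "\<And>j. j \<noteq> k \<Longrightarrow> x j = 0"
    using disjoint_terms_cases[of x, OF assms] by blast
  have "(\<Sum>j. x j) = x k" "(\<Sum>j. x j * x j) = x k * x k"
    using suminf_finite[of "{k}" x] suminf_finite[of "{k}" "\<lambda>j. x j * x j"] k by simp_all
  then show ?thesis by simp
qed

lemma integral_disjoint_series:
  fixes u :: "nat \<Rightarrow> complex \<Rightarrow> complex"
  assumes h: "integrable dA h"
    and u: "\<And>k. u k \<in> borel_measurable dA"
    and bd: "\<And>k z. z \<in> ball 0 1 \<Longrightarrow> norm (u k z) \<le> B"
    and disj: "\<And>j k z. j \<noteq> k \<Longrightarrow> u j z = 0 \<or> u k z = 0"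
  shows "(\<lambda>k. LINT z|dA. h z * cnj (u k z)) sums (LINT z|dA. h z * cnj (\<Sum>k. u k z))"
proof -
  note [measurable] = u borel_measurable_integrable[OF h]
  have int: "integrable dA (\<lambda>z. h z * cnj (u k z))" for k
  proof (rule Bochner_Integration.integrable_bound)
    show "integrable dA (\<lambda>z. B *\<^sub>R h z)" using h by simp
    show "AE z in dA. norm (h z * cnj (u k z)) \<le> norm (B *\<^sub>R h z)"
    proof (rule AE_I2)
      fix z assume "z \<in> space dA"
      then have "norm (u k z) \<le> \<bar>B\<bar>" using bd[of z k] by simp
      then show "norm (h z * cnj (u k z)) \<le> norm (B *\<^sub>R h z)"
        by (simp add: norm_mult mult_left_mono mult.commute[of "\<bar>B\<bar>"])
    qed
  qed measurable
  have "(\<lambda>n. LINT z|dA. h z * cnj (\<Sum>k<n. u k z)) \<longlonglongrightarrow> (LINT z|dA. h z * cnj (\<Sum>k. u k z))"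
  proof (rule integral_dominated_convergence[where w="\<lambda>z. B * norm (h z)"])
    show "integrable dA (\<lambda>z. B * norm (h z))" using h by simp
    show "AE z in dA. (\<lambda>n. h z * cnj (\<Sum>k<n. u k z)) \<longlonglongrightarrow> h z * cnj (\<Sum>k. u k z)"
    proof (rule AE_I2)
      fix z
      have "(\<lambda>n. \<Sum>k<n. u k z) \<longlonglongrightarrow> (\<Sum>k. u k z)"
        using disjoint_terms_sums[of "\<lambda>k. u k z", OF disj] by (simp add: sums_def)
      then show "(\<lambda>n. h z * cnj (\<Sum>k<n. u k z)) \<longlonglongrightarrow> h z * cnj (\<Sum>k. u k z)"
        by (intro tendsto_intros)
    qed
    show "AE z in dA. norm (h z * cnj (\<Sum>k<n. u k z)) \<le> B * norm (h z)" for n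
    proof (rule AE_I2)
      fix z assume "z \<in> space dA"
      then have "norm (\<Sum>k<n. u k z) \<le> B"
        using disjoint_terms_sum_bound(1)[of "\<lambda>k. u k z", OF disj] bd by simp
      then have "norm (h z) * norm (\<Sum>k<n. u k z) \<le> norm (h z) * B"
        by (rule mult_left_mono) simp
      then show "norm (h z * cnj (\<Sum>k<n. u k z)) \<le> B * norm (h z)"
        by (simp only: norm_mult complex_mod_cnj mult.commute)
    qed
  qed measurable
  moreover have "(LINT z|dA. h z * cnj (\<Sum>k<n. u k z)) = (\<Sum>k<n. LINT z|dA. h z * cnj (u k z))" for n
    using int by (simp add: sum_distrib_left)
  ultimately show ?thesis by (simp add: sums_def)
qed

section \<open>The function whose square leaves the space\<close>

definition balanced_step :: "real \<Rightarrow> real" where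
  "balanced_step x = indicator {1/4..<1/2} x - indicator {1/2..<3/4} x"

text \<open>For the weight |z|^(2(N-1)) dA with N = 5^k, the variable |z|^(2N) has constant density
  1/N on [0,1), so the exponent N - 1 makes the two intervals of \<open>balanced_step\<close>, of
  length 1/4 each, cancel. Their union stays away from 0, for the lower bound on the square, and
  from 1, to keep each single term off the unit circle.\<close>

definition lacunary_term :: "nat \<Rightarrow> complex \<Rightarrow> complex" where
  "lacunary_term k z = of_real (balanced_step (norm z ^ (2 * 5 ^ k))) * z ^ (5 ^ k - 1)"

definition lacunary_series :: "complex \<Rightarrow> complex" where
  "lacunary_series z = (\<Sum>k. lacunary_term k z)"

lemma balanced_step_measurable [measurable]: "balanced_step \<in> borel_measurable borel"
  unfolding balanced_step_def by measurable

lemma abs_balanced_step_le_1: "\<bar>balanced_step x\<bar> \<le> 1"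
  by (auto simp: balanced_step_def indicator_def)

lemma balanced_step_square: "(balanced_step x)\<^sup>2 = indicator {1/4..<3/4} x"
  by (auto simp: balanced_step_def indicator_def)

lemma balanced_step_nonzero: "balanced_step x \<noteq> 0 \<longleftrightarrow> 1/4 \<le> x \<and> x < 3/4"
  by (auto simp: balanced_step_def indicator_def)

lemma lacunary_term_measurable [measurable]: "lacunary_term k \<in> borel_measurable borel"
  unfolding lacunary_term_def[abs_def] by measurable

lemma norm_lacunary_term_le_1: "z \<in> ball 0 1 \<Longrightarrow> norm (lacunary_term k z) \<le> 1"
  using mult_mono[OF abs_balanced_step_le_1 power_le_one[of "norm z"]]
  by (simp add: lacunary_term_def norm_mult norm_power)

text \<open>The supports are disjoint because \<open>(3/4)\<^sup>5 < 1/4\<close>.\<close>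

lemma lacunary_term_disjoint:
  assumes "j \<noteq> k"
  shows "lacunary_term j z = 0 \<or> lacunary_term k z = 0"
proof -
  have "balanced_step (r ^ (2 * 5 ^ k)) = 0"
    if "j < k" "balanced_step (r ^ (2 * 5 ^ j)) \<noteq> 0" "0 \<le> r" for r :: real and j k :: nat
  proof -
    define x where "x = r ^ (2 * 5 ^ j)"
    have x: "1/4 \<le> x" "x < 3/4" using that(2) by (simp_all add: balanced_step_nonzero x_def)
    \<comment> \<open>The argument for \<open>k\<close> is the power
      \<open>5 ^ (k - j) \<ge> 5\<close> of the argument \<open>x\<close> for \<open>j\<close>,
      hence below 243/1024 < 1/4.\<close>
    have "k = j + (k - j)" using that(1) by simp
    then have "r ^ (2 * 5 ^ k) = x ^ 5 ^ (k - j)"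
      by (metis (no_types) mult.assoc power_add power_mult x_def)
    also have "\<dots> \<le> x ^ 5 ^ 1"
      using x that(1) by (intro power_decreasing power_increasing) auto
    also have "\<dots> \<le> (3/4) ^ 5 ^ 1"
      using x by (intro power_mono) auto
    also have "\<dots> < (1/4 :: real)" by (simp add: power_divide)
    finally show ?thesis
      using balanced_step_nonzero by force
  qed
  then show ?thesis
    using assms norm_ge_zero[of z] unfolding lacunary_term_def
    by (metis linorder_neqE_nat mult_zero_left of_real_0)
qed

lemma lacunary_series_measurable [measurable]: "lacunary_series \<in> borel_measurable borel"
  unfolding lacunary_series_def[abs_def] by measurable

lemma norm_lacunary_series_le_1: "z \<in> ball 0 1 \<Longrightarrow> norm (lacunary_series z) \<le> 1"
  unfolding lacunary_series_def
  by (rule disjoint_terms_sum_bound(2)) (erule lacunary_term_disjoint, erule norm_lacunary_term_le_1)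

section \<open>Orthogonality to the Bergman space\<close>

lemma integrable_annulus:
  "integrable dA (\<lambda>z. indicator {a..<b} (norm z ^ m) * norm z ^ n :: real)"
proof (rule dA.integrable_const_bound)
  show "AE z in dA. norm (indicator {a..<b} (norm z ^ m) * norm z ^ n :: real) \<le> 1"
    by (rule AE_I2) (auto simp: indicator_def power_le_one)
  show "(\<lambda>z. indicator {a..<b} (norm z ^ m) * norm z ^ n :: real) \<in> borel_measurable dA"
    by (rule borel_measurable_dA) measurable
qed

lemma integral_lacunary_term_eq_0:
  assumes h: "h \<in> bergman_A1"
  shows "(LINT z|dA. h z * cnj (lacunary_term k z)) = 0"
proof -
  define N where "N = (5::nat) ^ k"
  have N: "N > 0" by (simp add: N_def)
  \<comment> \<open>The outer radius of the outer annulus. It is below 1 for each \<open>k\<close>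
    but tends to 1 as \<open>k\<close> grows, so the Taylor argument is applied to one term at a
    time.\<close>
  define \<rho> where "\<rho> = root (2 * N) (3/4)"
  have \<rho>: "0 < \<rho>" "\<rho> < 1" "\<rho> ^ (2 * N) = 3/4"
    using N by (auto simp: \<rho>_def)
  have "(LINT z|dA. h z * cnj (of_real (balanced_step (norm z ^ (2 * N))) * z ^ (N - 1))) = 0"
  proof (rule integral_holomorphic_radial)
    show "h holomorphic_on ball 0 1" using h by (simp add: bergman_A1_def)
    show "balanced_step (r ^ (2 * N)) = 0" if "\<rho> \<le> r" for r
      using power_mono[OF that, of "2 * N"] \<rho> balanced_step_nonzero[of "r ^ (2 * N)"] by auto
    have "(LINT z|dA. balanced_step (norm z ^ (2 * N)) * norm z ^ (2 * (N - 1)))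
        = (LINT z|dA. indicator {1/4..<1/2} (norm z ^ (2 * N)) * norm z ^ (2 * (N - 1)))
        - (LINT z|dA. indicator {1/2..<3/4} (norm z ^ (2 * N)) * norm z ^ (2 * (N - 1)))"
      unfolding balanced_step_def left_diff_distrib
      by (intro Bochner_Integration.integral_diff integrable_annulus)
    also have "\<dots> = 0"
      using N integral_dA_norm_power_annulus[of "1/4" "1/2" N] integral_dA_norm_power_annulus[of "1/2" "3/4" N]
      by simp
    finally show "(LINT z|dA. balanced_step (norm z ^ (2 * N)) * norm z ^ (2 * (N - 1))) = 0" .
  qed (use \<rho> abs_balanced_step_le_1 in simp_all)
  then show ?thesis by (simp add: lacunary_term_def N_def)
qed

text \<open>The supports accumulate at the unit circle, so the vanishing of the single pairings is
  carried over to the sum by dominated convergence with majorant |h|.\<close>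

lemma lacunary_series_in_A1_perp: "lacunary_series \<in> A1_perp"
  unfolding A1_perp_def Linf_def
proof (intro CollectI conjI ballI exI)
  show "lacunary_series \<in> borel_measurable dA" by (rule borel_measurable_dA) simp
  show "AE z in dA. norm (lacunary_series z) \<le> 1"
    by (rule AE_I2) (simp add: norm_lacunary_series_le_1)
  fix h assume h: "h \<in> bergman_A1"
  then have "integrable dA h" by (simp add: bergman_A1_def)
  then have "(\<lambda>k. LINT z|dA. h z * cnj (lacunary_term k z)) sums (LINT z|dA. h z * cnj (lacunary_series z))"
    unfolding lacunary_series_def
    by (rule integral_disjoint_series[where B = 1])
      (simp_all add: borel_measurable_dA norm_lacunary_term_le_1 lacunary_term_disjoint)
  then show "(LINT z|dA. h z * cnj (lacunary_series z)) = 0"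
    by (simp add: integral_lacunary_term_eq_0[OF h] sums_iff)
qed

section \<open>The square paired with powers of \<open>z\<close>, and the contradiction\<close>

lemma integrable_dA_power: "integrable dA (\<lambda>z. z ^ n)"
proof (rule dA.integrable_const_bound)
  show "AE z in dA. norm (z ^ n) \<le> 1"
    by (rule AE_I2) (simp add: norm_power power_le_one)
  show "(\<lambda>z. z ^ n) \<in> borel_measurable dA" by (rule borel_measurable_dA) measurable
qed

lemma power_in_bergman_A1: "(\<lambda>z. z ^ n) \<in> bergman_A1"
  unfolding bergman_A1_def by (intro CollectI conjI holomorphic_intros integrable_dA_power)

lemma integrable_power_Linf:
  assumes "\<psi> \<in> Linf"
  shows "integrable dA (\<lambda>z. z ^ n * cnj (\<psi> z))"
proof -
  obtain B where [measurable]: "\<psi> \<in> borel_measurable dA" and B: "AE z in dA. norm (\<psi> z) \<le> B"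
    using assms by (auto simp: Linf_def)
  note [measurable] = borel_measurable_integrable[OF integrable_dA_power]
  have "AE z in dA. z \<in> ball 0 1" by (rule AE_I2) simp
  with B have "AE z in dA. norm (z ^ n * cnj (\<psi> z)) \<le> B"
  proof eventually_elim
    case (elim z)
    then have "norm z ^ n * norm (\<psi> z) \<le> 1 * B" by (intro mult_mono power_le_one) auto
    then show ?case by (simp add: norm_mult norm_power)
  qed
  then show ?thesis by (rule dA.integrable_const_bound) measurable
qed

text \<open>The squared terms are radial multiples of monomials of distinct degrees 2(5^j - 1), so
  the test power selects the term j = k. What remains is at least 1/4 of the weight (3/4 - 1/4) / N
  of its annulus.\<close>

lemma lacunary_series_square_coefficient:
  fixes k :: nat
  defines "N \<equiv> 5 ^ k"
  shows "1 / (8 * real N) \<le> norm (LINT z|dA. z ^ (2 * (N - 1)) * cnj (lacunary_series z * lacunary_series z))"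
proof -
  have N: "N > 0" by (simp add: N_def)
  define I where "I = (LINT z|dA. indicator {1/4..<3/4} (norm z ^ (2 * N)) * norm z ^ (4 * (N - 1)) :: real)"
  have sq: "lacunary_term j z * lacunary_term j z
      = of_real (indicator {1/4..<3/4} (norm z ^ (2 * 5 ^ j))) * z ^ (2 * (5 ^ j - 1))" for j z
    by (simp add: lacunary_term_def flip: balanced_step_square)
      (simp add: power2_eq_square power_mult mult.commute mult.left_commute power_mult_distrib)
  have coeff: "(LINT z|dA. z ^ (2 * (N - 1)) * cnj (lacunary_term j z * lacunary_term j z))
      = (if j = k then of_real I else 0)" for j
  proof (cases "j = k")
    case True
    have "z ^ (2 * (N - 1)) * cnj (lacunary_term j z * lacunary_term j z)
        = of_real (indicator {1/4..<3/4} (norm z ^ (2 * N)) * norm z ^ (4 * (N - 1)))" for z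
    proof -
      have "z ^ (2 * (N - 1)) * cnj z ^ (2 * (N - 1)) = of_real ((norm z)\<^sup>2) ^ (2 * (N - 1))"
        by (simp only: power_mult_distrib[symmetric] complex_norm_square)
      also have "\<dots> = of_real (norm z ^ (4 * (N - 1)))"
        by (simp flip: power_mult)
      finally show ?thesis
        unfolding sq True N_def[symmetric] by simp
    qed
    then show ?thesis
      using True by (simp only: integral_complex_of_real I_def if_True simp_thms)
  next
    case False
    have "2 * (N - 1) \<noteq> 2 * (5 ^ j - 1)"
    proof
      assume "2 * (N - 1) = 2 * (5 ^ j - 1)"
      then have "N = 5 ^ j" using N zero_less_power[of "5::nat" j] by linarith
      then show False using False by (simp add: N_def)
    qed
    then show ?thesis
      unfolding sq using False
      by (subst integral_monomials_radial_eq_0[of "\<lambda>r. indicator {1/4..<3/4} (r ^ (2 * 5 ^ j))"]) simp_all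
  qed
  have sums: "(\<lambda>j. LINT z|dA. z ^ (2 * (N - 1)) * cnj (lacunary_term j z * lacunary_term j z))
      sums (LINT z|dA. z ^ (2 * (N - 1)) * cnj (\<Sum>j. lacunary_term j z * lacunary_term j z))"
  proof (rule integral_disjoint_series[OF integrable_dA_power])
    show "norm (lacunary_term j z * lacunary_term j z) \<le> 1" if "z \<in> ball 0 1" for j z
      using norm_lacunary_term_le_1[OF that, of j] by (simp add: norm_mult mult_le_one)
    show "(\<lambda>z. lacunary_term j z * lacunary_term j z) \<in> borel_measurable dA" for j
      by (rule borel_measurable_dA) measurable
  qed (use lacunary_term_disjoint in auto)
  have "lacunary_series z * lacunary_series z = (\<Sum>j. lacunary_term j z * lacunary_term j z)" for z
    unfolding lacunary_series_def by (rule disjoint_terms_suminf_square) (rule lacunary_term_disjoint)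
  then have eq: "(LINT z|dA. z ^ (2 * (N - 1)) * cnj (lacunary_series z * lacunary_series z)) = of_real I"
    using sums_unique2[OF sums[unfolded coeff] sums_single[of k "\<lambda>_. of_real I"]] by simp
  have "1 / (8 * real N) = 1/4 * (LINT z|dA. indicator {1/4..<3/4} (norm z ^ (2 * N)) * norm z ^ (2 * (N - 1)))"
    using N integral_dA_norm_power_annulus[of "1/4" "3/4" N] by simp
  also have "\<dots> = (LINT z|dA. 1/4 * (indicator {1/4..<3/4} (norm z ^ (2 * N)) * norm z ^ (2 * (N - 1))))"
    by simp
  also have "\<dots> \<le> I"
    unfolding I_def
  proof (rule integral_mono)
    fix z assume z: "z \<in> space dA"
    \<comment> \<open>As |z| < 1, |z|^(2(N-1)) \<ge> |z|^(2N) \<ge> 1/4; one of two such factors is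
      traded for 1/4.\<close>
    have "1/4 * norm z ^ (2 * (N - 1)) \<le> norm z ^ (4 * (N - 1))" if "1/4 \<le> norm z ^ (2 * N)"
    proof -
      have "1/4 \<le> norm z ^ (2 * (N - 1))"
        using that z power_decreasing[of "2 * (N - 1)" "2 * N" "norm z"] by simp
      then have "1/4 * norm z ^ (2 * (N - 1)) \<le> norm z ^ (2 * (N - 1)) * norm z ^ (2 * (N - 1))"
        by (rule mult_right_mono) simp
      also have "\<dots> = norm z ^ (4 * (N - 1))" by (simp flip: power_add)
      finally show ?thesis .
    qed
    then show "1/4 * (indicator {1/4..<3/4} (norm z ^ (2 * N)) * norm z ^ (2 * (N - 1)))
        \<le> indicator {1/4..<3/4} (norm z ^ (2 * N)) * norm z ^ (4 * (N - 1))"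
      by (simp add: indicator_def)
  qed (simp_all only: integrable_annulus integrable_mult_right)
  finally show ?thesis unfolding eq by simp
qed

text \<open>Pairing a decomposition with z^(2(N-1)) kills the annihilator part, leaving at least
  1/(8N) on one side and at most 1/(16N) from the continuous part on the other.\<close>

lemma lacunary_series_square_notin: "(\<lambda>z. lacunary_series z * lacunary_series z) \<notin> A1_perp_plus_C"
proof
  assume "(\<lambda>z. lacunary_series z * lacunary_series z) \<in> A1_perp_plus_C"
  then obtain \<psi> \<phi> where eq: "\<And>z. lacunary_series z * lacunary_series z = \<psi> z + \<phi> z"
    and \<psi>: "\<psi> \<in> A1_perp" and \<phi>: "\<phi> \<in> C_closed_disc"
    unfolding A1_perp_plus_C_def by (auto simp: fun_eq_iff)
  from \<phi> obtain c where \<phi>L: "\<phi> \<in> Linf" and c: "continuous_on (cball 0 1) c"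
    and ae: "AE z in dA. \<phi> z = c z"
    by (auto simp: C_closed_disc_def)
  have [measurable]: "\<phi> \<in> borel_measurable dA" using \<phi>L by (simp add: Linf_def)
  have "c \<in> borel_measurable (lebesgue_on (ball 0 1))"
    by (rule continuous_imp_measurable_on_sets_lebesgue) (auto intro: continuous_on_subset[OF c])
  moreover have "measurable dA borel = measurable (lebesgue_on (ball (0::complex) 1)) borel"
    by (rule measurable_cong_sets) (simp_all add: dA_def)
  ultimately have [measurable]: "c \<in> borel_measurable dA" by blast
  \<comment> \<open>Any constant below 1/8 would do, since the integral of |z|^(2(N-1)) is
    1/N.\<close>
  obtain n0 where n0:
    "\<And>n. n \<ge> n0 \<Longrightarrow> norm (LINT z|dA. z ^ n * cnj (c z)) \<le> 1/16 * (LINT z|dA. norm z ^ n)"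
    using Riemann_Lebesgue_disc[OF c, of "1/16"] by auto
  \<comment> \<open>The threshold serves as the exponent itself: 5^n0 > n0 gives 2(N - 1) \<ge>
    n0.\<close>
  define N where "N = (5::nat) ^ n0"
  define n where "n = 2 * (N - 1)"
  have N: "N > 0" by (simp add: N_def)
  have "n0 < 5 ^ n0" by (rule power_gt_expt) simp
  then have "n \<ge> n0" by (simp add: n_def N_def)
  note [measurable] = borel_measurable_integrable[OF integrable_dA_power]
  have "(LINT z|dA. z ^ n * cnj (lacunary_series z * lacunary_series z))
      = (LINT z|dA. z ^ n * cnj (\<psi> z)) + (LINT z|dA. z ^ n * cnj (\<phi> z))"
    unfolding eq complex_cnj_add distrib_left using \<psi> \<phi>L
    by (intro Bochner_Integration.integral_add integrable_power_Linf) (auto simp: A1_perp_def)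
  also have "(LINT z|dA. z ^ n * cnj (\<psi> z)) = 0"
    using \<psi> power_in_bergman_A1[of n] by (auto simp: A1_perp_def)
  also have "(LINT z|dA. z ^ n * cnj (\<phi> z)) = (LINT z|dA. z ^ n * cnj (c z))"
    by (rule integral_cong_AE) (use ae in \<open>measurable, auto\<close>)
  finally have "1 / (8 * real N) \<le> norm (LINT z|dA. z ^ n * cnj (c z))"
    using lacunary_series_square_coefficient[of n0] by (simp add: N_def n_def)
  also have "\<dots> \<le> 1/16 * (LINT z|dA. norm z ^ n)"
    by (rule n0) fact
  \<comment> \<open>The whole disc counts as the annulus with a = 0 and b = 1.\<close>
  also have "(LINT z|dA. norm z ^ n) = (LINT z|dA. indicator {0..<1} (norm z ^ (2 * N)) * norm z ^ (2 * (N - 1)))"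
    using N by (intro Bochner_Integration.integral_cong) (auto simp: indicator_def n_def power_less_one_iff)
  also have "\<dots> = 1 / N"
    using integral_dA_norm_power_annulus[of 0 1 N] N by simp
  finally show False
    using N by (simp add: field_simps)
qed

theorem corollary1:
  shows "\<not> (\<forall>f \<in> A1_perp_plus_C. \<forall>g \<in> A1_perp_plus_C. (\<lambda>z. f z * g z) \<in> A1_perp_plus_C)"
proof -
  \<comment> \<open>With zero as continuous summand, the annihilator lies in the sum, and both
    factors can be taken to be \<open>lacunary_series\<close>.\<close>
  have "(\<lambda>z. 0) \<in> C_closed_disc"
    unfolding C_closed_disc_def Linf_def by (auto intro!: exI[of _ "\<lambda>z. 0"] exI[of _ 0])
  then have "lacunary_series \<in> A1_perp_plus_C"
    unfolding A1_perp_plus_C_def using lacunary_series_in_A1_perp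
    by (intro CollectI exI[of _ lacunary_series] exI[of _ "\<lambda>z. 0"]) simp
  then show ?thesis
    using lacunary_series_square_notin by blast
qed

end
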